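(* Consider the noise-tolerant regularized quasi-Newton algorithm described in the context, run for $k_{\max}$ iterations on a continuously differentiable function $f:\mathbb{R}^n\to\mathbb{R}$ with inexact values $\overline f$ satisfying $|f(x)-\overline f(x)|\le\epsilon_{\mathrm f}\max(1,|f(x)|)$ for all $x\in\mathbb{R}^n$ (with $0\le\epsilon_{\mathrm f}<1$) and exact gradients. Assume: (1) $f$ is bounded below: $f^*:=\inf_{x\in\mathbb{R}^n}f(x)>-\infty$; (2) $f$ is $L$-smooth: there is a constant $L>0$ with $f(y)\le f(x)+\nabla f(x)^\top(y-x)+\frac L2\|y-x\|^2$ for all $x,y\in\mathbb{R}^n$; (3) there are constants $0<m\le M$ such that $mI\preceq B_k\preceq MI$ for all $k$. Then the average of the squared gradient norms generated by the algorithm satisfies $$\frac1{k_{\max}}\sum_{k=0}^{k_{\max}-1}\|g_k\|^2=O\!\left(\frac1{k_{\max}}\right),$$ that is, with $f,\overline f,x_0,\epsilon_{\mathrm f},L,m,M$ and the algorithmic parameters $c,\beta_{\min},\beta_{\max},\theta_{\min},\theta_{\max},\varsigma$ fixed, there is a constant $C$, independent of $k_{\max}$, such that the left-hand side is at most $C/k_{\max}$ for every $k_{\max}\ge1$.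
   Context: $\|\cdot\|$ is the Euclidean norm. Gradients are available exactly; $g_k:=\nabla f(x_k)$. Algorithm. Inputs: $x_0\in\mathbb{R}^n$, an integer $k_{\max}>0$, $0\le\epsilon_{\mathrm f}<1$, $0<\theta_{\min}\le\theta_{\max}$, $0<\varsigma<1$, and line-search parameters $0<c<1$, $0<\beta_{\min}<\beta_{\max}<1$. Start with $K^0=K^+=\emptyset$. For $k=0,1,\dots,k_{\max}-1$: (a) If $\min_{j\in K^0}(\overline f(x_j)-\Delta_j)\ge\overline f(x_k)$ (the minimum over the empty set is $+\infty$; at this moment $K^0$ contains only indices $<k$), add $k$ to $K^0$ and set $\mu_k=0$. Otherwise add $k$ to $K^+$ and set $\mu_k=\theta_k\sqrt{\varsigma+\sum_{j\in K^+,\,j\le k}\|g_j\|^2}$ with some $\theta_k\in[\theta_{\min},\theta_{\max}]$ (arbitrary). (b) Set $d_k=-(B_k+\mu_kI)^{-1}g_k$, where $B_k\in\mathbb{R}^{n\times n}$ is a symmetric approximate Hessian (arbitrary subject to the assumptions stated in the claim). (c) Backtracking line search: start with $\alpha_k=1$; at each trial $\alpha_k$ put $\Delta_k=\frac{2\epsilon_{\mathrm f}}{1-\epsilon_{\mathrm f}}\max(1,\overline f(x_k),-\overline f(x_k+\alpha_kd_k))$; while $\overline f(x_k)+c\,\alpha_kg_k^\top d_k+\Delta_k<\overline f(x_k+\alpha_kd_k)$, replace $\alpha_k$ by $\beta\alpha_k$ for some $\beta\in[\beta_{\min},\beta_{\max}]$ (possibly different at each rejection) and recompute $\Delta_k$.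 The final $\alpha_k$, $\Delta_k$ are the accepted ones. (d) Set $x_{k+1}=x_k+\alpha_kd_k$ and $g_{k+1}=\nabla f(x_{k+1})$. *)

theory Defs
  imports "HOL-Analysis.Analysis"
begin

definition symmetric_mat :: "real^'n^'n \<Rightarrow> bool" where
  "symmetric_mat A \<longleftrightarrow> transpose A = A"

definition pos_semidef :: "real^'n^'n \<Rightarrow> bool" where
  "pos_semidef A \<longleftrightarrow> symmetric_mat A \<and> (\<forall>v. 0 \<le> v \<bullet> (A *v v))"

definition loewner_le :: "real^'n^'n \<Rightarrow> real^'n^'n \<Rightarrow> bool" (infix "\<preceq>\<^sub>L" 50) where
  "A \<preceq>\<^sub>L B \<longleftrightarrow> pos_semidef (B - A)"

record ('n::finite) alg_params =
  x_init :: "real^'n"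
  eps_f :: real
  theta_min :: real
  theta_max :: real
  vsig :: real
  c_ls :: real
  beta_min :: real
  beta_max :: real

definition admissible_params :: "('n::finite) alg_params \<Rightarrow> bool" where
  "admissible_params P \<longleftrightarrow>
     0 \<le> eps_f P \<and> eps_f P < 1 \<and>
     0 < theta_min P \<and> theta_min P \<le> theta_max P \<and>
     0 < vsig P \<and> vsig P < 1 \<and>
     0 < c_ls P \<and> c_ls P < 1 \<and>
     0 < beta_min P \<and> beta_min P < beta_max P \<and> beta_max P < 1"

definition ls_tol :: "('n::finite) alg_params \<Rightarrow> (real^'n \<Rightarrow> real) \<Rightarrow> real^'n \<Rightarrow> real^'n \<Rightarrow> real \<Rightarrow> real" where
  "ls_tol P fbar x d \<alpha> =
     2 * eps_f P / (1 - eps_f P) * max 1 (max (fbar x) (- fbar (x + \<alpha> *\<^sub>R d)))"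

definition ls_rejects ::
  "('n::finite) alg_params \<Rightarrow> (real^'n \<Rightarrow> real) \<Rightarrow> real^'n \<Rightarrow> real^'n \<Rightarrow> real^'n \<Rightarrow> real \<Rightarrow> bool" where
  "ls_rejects P fbar x g d \<alpha> \<longleftrightarrow>
     fbar x + c_ls P * \<alpha> * (g \<bullet> d) + ls_tol P fbar x d \<alpha> < fbar (x + \<alpha> *\<^sub>R d)"

text \<open>The step sizes that backtracking may try: a trial is followed by another one only if it
  is rejected, and the contraction factor is chosen anew at each rejection.\<close>

inductive ls_trial ::
  "('n::finite) alg_params \<Rightarrow> (real^'n \<Rightarrow> real) \<Rightarrow> real^'n \<Rightarrow> real^'n \<Rightarrow> real^'n \<Rightarrow> real \<Rightarrow> bool"
  for P fbar x g d where
  start: "ls_trial P fbar x g d 1"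
| shrink: "ls_trial P fbar x g d \<alpha> \<Longrightarrow> ls_rejects P fbar x g d \<alpha> \<Longrightarrow>
     beta_min P \<le> \<beta> \<Longrightarrow> \<beta> \<le> beta_max P \<Longrightarrow> ls_trial P fbar x g d (\<beta> * \<alpha>)"

definition ls_accepts ::
  "('n::finite) alg_params \<Rightarrow> (real^'n \<Rightarrow> real) \<Rightarrow> real^'n \<Rightarrow> real^'n \<Rightarrow> real^'n \<Rightarrow> real \<Rightarrow> bool" where
  "ls_accepts P fbar x g d \<alpha> \<longleftrightarrow> ls_trial P fbar x g d \<alpha> \<and> \<not> ls_rejects P fbar x g d \<alpha>"

text \<open>\<open>Kzero R k\<close> and \<open>Kplus R k\<close> are the contents of the two index sets at the beginning of
  iteration \<open>k\<close>. All other components at \<open>k\<close> are the quantities produced in iteration \<open>k\<close>;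
  \<open>stepsize R k\<close> and \<open>tol R k\<close> are the accepted line-search values. Only the entries up to the
  length of the run are constrained.\<close>

record ('n::finite) trace =
  iter :: "nat \<Rightarrow> real^'n"
  Kzero :: "nat \<Rightarrow> nat set"
  Kplus :: "nat \<Rightarrow> nat set"
  reg :: "nat \<Rightarrow> real"
  hess :: "nat \<Rightarrow> real^'n^'n"
  dir :: "nat \<Rightarrow> real^'n"
  stepsize :: "nat \<Rightarrow> real"
  tol :: "nat \<Rightarrow> real"

text \<open>The infimum is taken in the extended reals, so that it is \<open>\<infinity>\<close> when \<open>Kzero R k\<close> is empty.\<close>

definition zero_reg_test :: "(real^'n \<Rightarrow> real) \<Rightarrow> 'n trace \<Rightarrow> nat \<Rightarrow> bool" where
  "zero_reg_test fbar R k \<longleftrightarrow>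
     (INF j\<in>Kzero R k. ereal (fbar (iter R j) - tol R j)) \<ge> ereal (fbar (iter R k))"

definition reg_update ::
  "('n::finite) alg_params \<Rightarrow> (real^'n \<Rightarrow> real^'n) \<Rightarrow> (real^'n \<Rightarrow> real) \<Rightarrow> 'n trace \<Rightarrow> nat \<Rightarrow> bool" where
  "reg_update P gradf fbar R k \<longleftrightarrow>
     (if zero_reg_test fbar R k
      then Kzero R (Suc k) = insert k (Kzero R k) \<and> Kplus R (Suc k) = Kplus R k \<and> reg R k = 0
      else Kzero R (Suc k) = Kzero R k \<and> Kplus R (Suc k) = insert k (Kplus R k) \<and>
        (\<exists>\<theta>\<in>{theta_min P..theta_max P}.
           reg R k = \<theta> * sqrt (vsig P +
             (\<Sum>j\<in>{j \<in> Kplus R (Suc k). j \<le> k}. (norm (gradf (iter R j)))\<^sup>2))))"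

text \<open>The constant \<open>mat \<mu>\<close> is \<open>\<mu>\<close> times the identity matrix.\<close>

definition iteration ::
  "('n::finite) alg_params \<Rightarrow> (real^'n \<Rightarrow> real^'n) \<Rightarrow> (real^'n \<Rightarrow> real) \<Rightarrow> 'n trace \<Rightarrow> nat \<Rightarrow> bool" where
  "iteration P gradf fbar R k \<longleftrightarrow>
     reg_update P gradf fbar R k \<and>
     symmetric_mat (hess R k) \<and>
     dir R k = - (matrix_inv (hess R k + mat (reg R k)) *v gradf (iter R k)) \<and>
     ls_accepts P fbar (iter R k) (gradf (iter R k)) (dir R k) (stepsize R k) \<and>
     tol R k = ls_tol P fbar (iter R k) (dir R k) (stepsize R k) \<and>
     iter R (Suc k) = iter R k + stepsize R k *\<^sub>R dir R k"

definition run ::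
  "('n::finite) alg_params \<Rightarrow> (real^'n \<Rightarrow> real^'n) \<Rightarrow> (real^'n \<Rightarrow> real) \<Rightarrow> nat \<Rightarrow> 'n trace \<Rightarrow> bool" where
  "run P gradf fbar kmax R \<longleftrightarrow>
     iter R 0 = x_init P \<and> Kzero R 0 = {} \<and> Kplus R 0 = {} \<and>
     (\<forall>k<kmax. iteration P gradf fbar R k)"

end

theory Submission
  imports Defs
begin

text \<open>The tolerance absorbs the noise, so every step size at which the exact objective decreases
  sufficiently is accepted, and accepted step sizes stay above a constant \<open>a > 0\<close>. A step with
  \<open>\<mu>\<^sub>k = 0\<close> decreases \<open>f\<close> by a multiple of \<open>\<parallel>g\<^sub>k\<parallel>\<^sup>2\<close> up to a multiple of \<open>\<Delta>\<^sub>k\<close>, and the test that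
  selects these steps makes their \<open>\<Delta>\<^sub>k\<close> telescope against the noisy values. For the other steps only
  smoothness is used, not the acceptance test: as soon as \<open>\<mu>\<^sub>k \<ge> L\<close>, a step decreases \<open>f\<close> by at least
  \<open>a \<parallel>g\<^sub>k\<parallel>\<^sup>2 / (2 (M + \<mu>\<^sub>k))\<close>, while over the steps with \<open>\<mu>\<^sub>k < L\<close> the \<open>\<parallel>g\<^sub>k\<parallel>\<^sup>2\<close> sum to at most
  \<open>(L / \<theta>\<^sub>m\<^sub>i\<^sub>n)\<^sup>2\<close> by the choice of \<open>\<mu>\<^sub>k\<close>. Summing up, \<open>S = \<Sum> \<parallel>g\<^sub>k\<parallel>\<^sup>2\<close> over the regularized steps satisfies
  \<open>S \<le> const * (M + \<theta>\<^sub>m\<^sub>a\<^sub>x sqrt (vsig P + S))\<close>, which bounds \<open>S\<close>.\<close>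

section \<open>Quadratic forms and the regularized Newton direction\<close>

lemma loewner_le_quadratic_form:
  assumes "A \<preceq>\<^sub>L B"
  shows "v \<bullet> (A *v v) \<le> v \<bullet> (B *v v)"
  using assms unfolding loewner_le_def pos_semidef_def
  by (simp add: matrix_vector_mult_diff_rdistrib inner_diff_right)

lemma mat_mult_vec: "mat c *v v = c *\<^sub>R (v :: real^'n)"
  by (simp add: matrix_vector_mult_def mat_def vec_eq_iff if_distrib if_distribR
      cong: if_cong)

text \<open>Evaluate the form of \<open>A\<close> at \<open>v - A v / M\<close>.\<close>

lemma norm_sq_mult_le_quadratic_form:
  fixes A :: "real^'n^'n"
  assumes sym: "transpose A = A" and "0 < M"
    and pos: "\<And>v. 0 \<le> v \<bullet> (A *v v)"
    and le: "\<And>v. v \<bullet> (A *v v) \<le> M * (norm v)\<^sup>2"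
  shows "(norm (A *v v))\<^sup>2 \<le> M * (v \<bullet> (A *v v))"
proof -
  define w where "w = A *v v"
  have adj: "v \<bullet> (A *v w) = w \<bullet> w"
    using dot_lmul_matrix[of v A w] sym
    by (simp add: w_def flip: transpose_matrix_vector)
  have "0 \<le> (M *\<^sub>R v - w) \<bullet> (A *v (M *\<^sub>R v - w))"
    by (rule pos)
  also have "\<dots> = M * M * (v \<bullet> w) - 2 * M * (w \<bullet> w) + w \<bullet> (A *v w)"
    using adj
    by (simp add: matrix_vector_mult_diff_distrib matrix_vector_mult_scaleR inner_diff_left
        inner_diff_right w_def[symmetric] algebra_simps)
  also have "\<dots> \<le> M * (M * (v \<bullet> w) - w \<bullet> w)"
    using le[of w] by (simp add: power2_norm_eq_inner algebra_simps)
  finally have "0 \<le> M * (v \<bullet> w) - w \<bullet> w"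
    using \<open>0 < M\<close> by (simp add: zero_le_mult_iff)
  then show ?thesis
    by (simp add: power2_norm_eq_inner w_def)
qed

text \<open>Since \<open>A = B + mat \<mu>\<close> maps \<open>d\<close> to \<open>- g\<close>, the
  number \<open>- (g \<bullet> d)\<close> is the quadratic form of \<open>A\<close> at
  \<open>d\<close>. The Loewner bounds give the first two claims; the first and Cauchy-Schwarz give
  the third.\<close>

lemma regularized_newton_direction:
  fixes B :: "real^'n^'n"
  assumes "symmetric_mat B" "mat m \<preceq>\<^sub>L B" "B \<preceq>\<^sub>L mat M" and "0 < m" "m \<le> M" "0 \<le> \<mu>"
    and d: "d = - (matrix_inv (B + mat \<mu>) *v g)"
  shows "(m + \<mu>) * (norm d)\<^sup>2 \<le> - (g \<bullet> d)"
    and "(norm g)\<^sup>2 \<le> (M + \<mu>) * - (g \<bullet> d)"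
    and "(m + \<mu>) * norm d \<le> norm g"
proof -
  define A where "A = B + mat \<mu>"
  have Av: "A *v v = B *v v + \<mu> *\<^sub>R v" for v
    by (simp add: A_def matrix_vector_mult_add_rdistrib mat_mult_vec)
  have lower: "(m + \<mu>) * (norm v)\<^sup>2 \<le> v \<bullet> (A *v v)" for v
    using loewner_le_quadratic_form[OF assms(2), of v]
    by (simp add: Av mat_mult_vec inner_add_right power2_norm_eq_inner algebra_simps)
  have upper: "v \<bullet> (A *v v) \<le> (M + \<mu>) * (norm v)\<^sup>2" for v
    using loewner_le_quadratic_form[OF assms(3), of v]
    by (simp add: Av mat_mult_vec inner_add_right power2_norm_eq_inner algebra_simps)
  \<comment> \<open>Positive definiteness makes the kernel trivial, so that
    \<open>matrix_inv\<close> is a true inverse.\<close>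
  have "v = 0" if "A *v v = 0" for v
    using lower[of v] that assms(4,6) by (simp add: mult_le_0_iff)
  then have "invertible A"
    by (metis invertible_left_inverse matrix_left_invertible_ker)
  then have "A ** matrix_inv A = mat 1"
    unfolding invertible_def matrix_inv_def by (rule someI2_ex) blast
  then have "A *v (matrix_inv A *v g) = g"
    by (simp add: matrix_vector_mul_assoc)
  then have Ad: "A *v d = - g"
    unfolding d A_def[symmetric] by (simp add: linear_neg[OF matrix_vector_mul_linear])
  have q: "d \<bullet> (A *v d) = - (g \<bullet> d)"
    by (simp add: Ad inner_commute)
  show *: "(m + \<mu>) * (norm d)\<^sup>2 \<le> - (g \<bullet> d)"
    using lower[of d] q by simp
  have "transpose A = A"
    using assms(1) by (simp add: A_def symmetric_mat_def transpose_def mat_def vec_eq_iff)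
  moreover have "0 \<le> v \<bullet> (A *v v)" for v
    by (rule order_trans[OF _ lower]) (use assms in auto)
  ultimately show "(norm g)\<^sup>2 \<le> (M + \<mu>) * - (g \<bullet> d)"
    using norm_sq_mult_le_quadratic_form[of A "M + \<mu>" d] upper assms(4-6) q Ad by simp
  have "- (g \<bullet> d) \<le> norm g * norm d"
    using Cauchy_Schwarz_ineq2[of g d] by linarith
  with * have "((m + \<mu>) * norm d) * norm d \<le> norm g * norm d"
    by (simp add: power2_eq_square mult.assoc)
  then show "(m + \<mu>) * norm d \<le> norm g"
    by (cases "d = 0") auto
qed

section \<open>Noise in the function values\<close>

text \<open>The noise is relative to the unknown exact value \<open>y\<close>; solving for
  \<open>max 1 \<bar>y\<bar>\<close> in terms of the measured bound costs the factor
  \<open>1 / (1 - e)\<close>.\<close>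

lemma noise_le_of_measured_bound:
  fixes y ybar t e :: real
  assumes "0 \<le> e" "e < 1" "\<bar>y - ybar\<bar> \<le> e * max 1 \<bar>y\<bar>" "\<bar>ybar\<bar> \<le> t" "1 \<le> t"
  shows "\<bar>y - ybar\<bar> \<le> e / (1 - e) * t"
proof -
  have "max 1 \<bar>y\<bar> * (1 - e) \<le> t"
  proof (cases "\<bar>y\<bar> \<le> 1")
    case True
    then show ?thesis using assms by simp
  next
    case False
    then show ?thesis using assms by (simp add: algebra_simps)
  qed
  then have "max 1 \<bar>y\<bar> \<le> t / (1 - e)"
    using assms(2) by (subst pos_le_divide_eq) auto
  then have "e * max 1 \<bar>y\<bar> \<le> e * (t / (1 - e))"
    using assms by (intro mult_left_mono)
  then show ?thesis using assms by simp
qed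

text \<open>When the exact value rises from \<open>b\<close> to \<open>y\<close>, the allowed noise
  grows by at most \<open>e * (y - b)\<close>, which does not exceed the rise.\<close>

lemma noise_lower:
  fixes y ybar b e :: real
  assumes "0 \<le> e" "e < 1" "\<bar>y - ybar\<bar> \<le> e * max 1 \<bar>y\<bar>" "b \<le> y"
  shows "b - e * max 1 \<bar>b\<bar> \<le> ybar"
proof -
  have "max 1 \<bar>y\<bar> \<le> max 1 \<bar>b\<bar> + (y - b)"
    using assms by linarith
  then have "e * max 1 \<bar>y\<bar> \<le> e * max 1 \<bar>b\<bar> + e * (y - b)"
    using assms by (metis mult_left_mono distrib_left)
  moreover have "e * (y - b) \<le> y - b"
    using assms by (simp add: mult_left_le_one_le)
  ultimately show ?thesis using assms by linarith
qed

text \<open>For a decrease of the exact values, both errors are controlled by the one-sided maximum in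
  the tolerance, because \<open>max (f x) (- f y)\<close> then bounds both absolute values.\<close>

lemma noise_le_of_decrease:
  fixes y z ybar zbar t e :: real
  assumes e: "0 \<le> e" "e < 1" and noise: "\<bar>y - ybar\<bar> \<le> e * max 1 \<bar>y\<bar>" "\<bar>z - zbar\<bar> \<le> e * max 1 \<bar>z\<bar>"
    and "z \<le> y"
  shows "zbar - ybar \<le> z - y + 2 * e / (1 - e) * max 1 (max ybar (- zbar))"
proof -
  define T where "T = max 1 (max ybar (- zbar))"
  have "1 \<le> T" "ybar \<le> T" "- zbar \<le> T" by (auto simp: T_def)
  have T: "1 - e \<le> T" using \<open>1 \<le> T\<close> e by linarith
  have y: "(1 - e) * y \<le> T"
  proof (cases "1 \<le> y")
    case True
    then show ?thesis using noise \<open>ybar \<le> T\<close> by (simp add: algebra_simps)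
  next
    case False
    then have "(1 - e) * y \<le> (1 - e) * 1" using e by (intro mult_left_mono) auto
    with T show ?thesis by simp
  qed
  have z: "(1 - e) * - z \<le> T"
  proof (cases "1 \<le> - z")
    case True
    then show ?thesis using noise \<open>- zbar \<le> T\<close> by (simp add: algebra_simps)
  next
    case False
    then have "(1 - e) * - z \<le> (1 - e) * 1" using e by (intro mult_left_mono) auto
    with T show ?thesis by simp
  qed
  define U where "U = T / (1 - e)"
  have "1 \<le> U" "y \<le> U" "- z \<le> U"
    using T y z e by (simp_all add: U_def pos_le_divide_eq mult.commute)
  then have "max 1 \<bar>y\<bar> \<le> U" "max 1 \<bar>z\<bar> \<le> U" using \<open>z \<le> y\<close> by auto
  then have "e * max 1 \<bar>y\<bar> \<le> e * U" "e * max 1 \<bar>z\<bar> \<le> e * U"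
    using e by (auto intro: mult_left_mono simp del: max.bounded_iff)
  then have "zbar - ybar \<le> z - y + 2 * (e * U)" using noise by linarith
  then show ?thesis by (simp add: U_def T_def)
qed

section \<open>The line search of a single iteration\<close>

context
  fixes f fbar :: "real^'n \<Rightarrow> real" and P :: "'n alg_params" and L m :: real and x g d :: "real^'n"
  assumes params: "admissible_params P"
    and noise: "\<And>x. \<bar>f x - fbar x\<bar> \<le> eps_f P * max 1 \<bar>f x\<bar>"
    and L_pos: "0 < L" and m_pos: "0 < m"
    and smooth: "\<And>y. f y \<le> f x + g \<bullet> (y - x) + L / 2 * (norm (y - x))\<^sup>2"
    and direction: "m * (norm d)\<^sup>2 \<le> - (g \<bullet> d)"
begin

lemma smooth_along_direction:
  "f (x + \<alpha> *\<^sub>R d) \<le> f x + \<alpha> * (g \<bullet> d) + L / 2 * \<alpha>\<^sup>2 * (norm d)\<^sup>2"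
  using smooth[of "x + \<alpha> *\<^sub>R d"] by (simp add: power_mult_distrib)

text \<open>For any smaller step the quadratic term of smoothness takes at most the fraction
  \<open>1 - c_ls P\<close> of the linear decrease, so the exact values decrease sufficiently and
  the tolerance absorbs the noise.\<close>

lemma ls_rejects_imp_large_step:
  assumes "0 < \<alpha>" "ls_rejects P fbar x g d \<alpha>"
  shows "2 * (1 - c_ls P) * m / L < \<alpha>"
proof (rule ccontr)
  assume "\<not> ?thesis"
  then have small: "\<alpha> * L \<le> 2 * (1 - c_ls P) * m"
    using L_pos by (simp add: pos_le_divide_eq not_less)
  have c: "0 < c_ls P" "c_ls P < 1" and e: "0 \<le> eps_f P" "eps_f P < 1"
    using params by (auto simp: admissible_params_def)
  have q: "0 \<le> - (g \<bullet> d)"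
    by (rule order_trans[OF _ direction]) (use m_pos in simp)
  have "L / 2 * \<alpha>\<^sup>2 * (norm d)\<^sup>2 = \<alpha> / 2 * (norm d)\<^sup>2 * (\<alpha> * L)"
    by (simp add: power2_eq_square)
  also have "\<dots> \<le> \<alpha> / 2 * (norm d)\<^sup>2 * (2 * (1 - c_ls P) * m)"
    using small assms(1) by (intro mult_left_mono) auto
  also have "\<dots> = \<alpha> * (1 - c_ls P) * (m * (norm d)\<^sup>2)"
    by simp
  also have "\<dots> \<le> \<alpha> * (1 - c_ls P) * - (g \<bullet> d)"
    using direction assms(1) c by (intro mult_left_mono) auto
  finally have dec: "f (x + \<alpha> *\<^sub>R d) \<le> f x + c_ls P * \<alpha> * (g \<bullet> d)"
    using smooth_along_direction[of \<alpha>] by (simp add: algebra_simps)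
  moreover have "0 \<le> c_ls P * \<alpha> * - (g \<bullet> d)"
    using q c assms(1) by (intro mult_nonneg_nonneg) auto
  \<comment> \<open>Plain decrease is what \<open>noise_le_of_decrease\<close> asks for.\<close>
  ultimately have "f (x + \<alpha> *\<^sub>R d) \<le> f x" by simp
  from noise_le_of_decrease[OF e noise noise this] dec assms(2) show False
    by (simp add: ls_rejects_def ls_tol_def)
qed

text \<open>Every trial other than \<open>1\<close> is at least \<open>beta_min P\<close> times a
  rejected one. Positivity joins the induction because the bound on rejected steps presupposes
  it.\<close>

lemma ls_trial_bounds:
  assumes "ls_trial P fbar x g d \<alpha>"
  shows "min 1 (beta_min P * (2 * (1 - c_ls P) * m / L)) \<le> \<alpha> \<and> 0 < \<alpha> \<and> \<alpha> \<le> 1"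
  using assms
proof induction
  case start
  show ?case by simp
next
  case (shrink \<alpha> \<beta>)
  have b: "0 < beta_min P" "beta_max P < 1"
    using params by (auto simp: admissible_params_def)
  have "beta_min P * (2 * (1 - c_ls P) * m / L) \<le> beta_min P * \<alpha>"
    using ls_rejects_imp_large_step[of \<alpha>] shrink b by (intro mult_left_mono) auto
  also have "\<dots> \<le> \<beta> * \<alpha>"
    using shrink by (intro mult_right_mono) auto
  finally have "beta_min P * (2 * (1 - c_ls P) * m / L) \<le> \<beta> * \<alpha>" .
  moreover have "\<beta> * \<alpha> \<le> 1"
    using shrink b by (intro mult_le_one) auto
  moreover have "0 < \<beta> * \<alpha>"
    using shrink b by (intro mult_pos_pos) auto
  ultimately show ?case by simp
qed

lemma accepted_step_decrease:
  assumes "0 < \<alpha>" "\<not> ls_rejects P fbar x g d \<alpha>"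
  shows "f (x + \<alpha> *\<^sub>R d) \<le> f x + c_ls P * \<alpha> * (g \<bullet> d) + 2 / (1 - eps_f P) * ls_tol P fbar x d \<alpha>"
proof -
  define T where "T = max 1 (max (fbar x) (- fbar (x + \<alpha> *\<^sub>R d)))"
  define E where "E = eps_f P / (1 - eps_f P)"
  have c: "0 < c_ls P" and e: "0 \<le> eps_f P" "eps_f P < 1"
    using params by (auto simp: admissible_params_def)
  have E: "0 \<le> E" "2 + 2 * E = 2 / (1 - eps_f P)"
    using e by (auto simp: E_def field_simps)
  have T: "1 \<le> T" "fbar x \<le> T" "- fbar (x + \<alpha> *\<^sub>R d) \<le> T"
    by (auto simp: T_def)
  define D where "D = ls_tol P fbar x d \<alpha>"
  have D: "D = 2 * E * T"
    by (simp add: D_def E_def T_def ls_tol_def)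
  have D0: "0 \<le> D" using D E T by simp
  have acc: "fbar (x + \<alpha> *\<^sub>R d) \<le> fbar x + c_ls P * \<alpha> * (g \<bullet> d) + D"
    using assms(2) by (simp add: ls_rejects_def D_def)
  have q: "0 \<le> - (g \<bullet> d)"
    by (rule order_trans[OF _ direction]) (use m_pos in simp)
  have "0 \<le> c_ls P * \<alpha> * - (g \<bullet> d)"
    using q c assms(1) by (intro mult_nonneg_nonneg) auto
  then have "fbar (x + \<alpha> *\<^sub>R d) \<le> fbar x + D" using acc by simp
  \<comment> \<open>\<open>T\<close> bounds \<open>fbar x\<close> only from above and the new value
    only from below; acceptance supplies the missing sides up to \<open>D\<close>.\<close>
  then have "\<bar>fbar x\<bar> \<le> T + D" "\<bar>fbar (x + \<alpha> *\<^sub>R d)\<bar> \<le> T + D" "1 \<le> T + D"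
    using T D0 by auto
  then have "\<bar>f x - fbar x\<bar> \<le> E * (T + D)"
      "\<bar>f (x + \<alpha> *\<^sub>R d) - fbar (x + \<alpha> *\<^sub>R d)\<bar> \<le> E * (T + D)"
    unfolding E_def using e noise noise_le_of_measured_bound by blast+
  \<comment> \<open>As \<open>2 * E * T\<close> is \<open>D\<close> again, acceptance and the noise
    at both points together cost \<open>(2 + 2 * E) * D\<close>.\<close>
  moreover have "D + 2 * (E * (T + D)) = 2 / (1 - eps_f P) * D"
    by (simp add: D E(2)[symmetric] algebra_simps)
  ultimately show ?thesis
    using acc unfolding D_def[symmetric] by linarith
qed

end

section \<open>Summation over the iterations\<close>

text \<open>Each \<open>\<delta> j\<close> is at most the drop of \<open>\<phi>\<close> to the next
  selected index, so the sum telescopes; \<open>v\<close> limits the last term.\<close>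

lemma sum_tolerances_le:
  fixes \<phi> \<delta> :: "nat \<Rightarrow> real"
  assumes "\<And>j k. k < n \<Longrightarrow> Q k \<Longrightarrow> j < k \<Longrightarrow> Q j \<Longrightarrow> \<phi> k \<le> \<phi> j - \<delta> j"
    and "\<And>k. k < n \<Longrightarrow> Q k \<Longrightarrow> \<phi> k \<le> b"
    and "\<And>j. j < n \<Longrightarrow> Q j \<Longrightarrow> v \<le> \<phi> j - \<delta> j" and "v \<le> b"
  shows "(\<Sum>j | j < n \<and> Q j. \<delta> j) \<le> b - v"
  using assms
proof (induction n arbitrary: v)
  case 0
  then show ?case by simp
next
  case (Suc n)
  show ?case
  proof (cases "Q n")
    case True
    then have *: "{j. j < Suc n \<and> Q j} = insert n {j. j < n \<and> Q j}"
      by (auto simp: less_Suc_eq)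
    \<comment> \<open>The lower bound \<open>v\<close> is replaced by \<open>\<phi> n\<close>, which
      no earlier \<open>\<phi> j - \<delta> j\<close> falls below.\<close>
    have "(\<Sum>j | j < n \<and> Q j. \<delta> j) \<le> b - \<phi> n"
      by (rule Suc.IH) (use Suc.prems True in auto)
    then show ?thesis
      using Suc.prems(3)[of n] True by (simp add: *)
  next
    case False
    then have *: "{j. j < Suc n \<and> Q j} = {j. j < n \<and> Q j}"
      by (auto simp: less_Suc_eq)
    show ?thesis unfolding *
      by (rule Suc.IH) (use Suc.prems in auto)
  qed
qed

text \<open>Although \<open>\<mu>\<close> may go up and down, at the last index with
  \<open>\<mu> k < L\<close> the running sum already contains every term counted here.\<close>

lemma sum_small_regularization_le:
  fixes s \<mu> :: "nat \<Rightarrow> real"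
  assumes "\<And>k. 0 \<le> s k" "0 < \<theta>" "0 \<le> \<sigma>" "0 \<le> L"
    and \<mu>: "\<And>k. k < n \<Longrightarrow> \<not> Q k \<Longrightarrow> \<theta> * sqrt (\<sigma> + (\<Sum>j | j \<le> k \<and> \<not> Q j. s j)) \<le> \<mu> k"
  shows "(\<Sum>k | k < n \<and> \<not> Q k \<and> \<mu> k < L. s k) \<le> (L / \<theta>)\<^sup>2"
proof -
  define W where "W = {k. k < n \<and> \<not> Q k \<and> \<mu> k < L}"
  have "finite W" by (simp add: W_def)
  have "sum s W \<le> (L / \<theta>)\<^sup>2"
  proof (cases "W = {}")
    case False
    define k where "k = Max W"
    have k: "k \<in> W" and max: "\<And>j. j \<in> W \<Longrightarrow> j \<le> k"
      using False \<open>finite W\<close> by (auto simp: k_def)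
    have "\<theta> * sqrt (\<sigma> + (\<Sum>j | j \<le> k \<and> \<not> Q j. s j)) \<le> L"
      using k \<mu>[of k] by (auto simp: W_def)
    then have "sqrt (\<sigma> + (\<Sum>j | j \<le> k \<and> \<not> Q j. s j)) \<le> L / \<theta>"
      using assms(2) by (simp add: pos_le_divide_eq mult.commute)
    then have "\<sigma> + (\<Sum>j | j \<le> k \<and> \<not> Q j. s j) \<le> (L / \<theta>)\<^sup>2"
      using real_le_rsqrt sqrt_le_D by blast
    moreover have "sum s W \<le> (\<Sum>j | j \<le> k \<and> \<not> Q j. s j)"
      using assms(1) max by (intro sum_mono2) (auto simp: W_def)
    ultimately show ?thesis using assms(3) by linarith
  qed simp
  then show ?thesis by (simp add: W_def)
qed

text \<open>The inequality between arithmetic and geometric mean lets the left side absorb half of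
  \<open>S\<close>.\<close>

lemma le_of_le_sqrt_growth:
  fixes S b M \<theta> \<sigma> :: real
  assumes "0 \<le> S" "0 \<le> \<sigma>" "S \<le> b * (M + \<theta> * sqrt (\<sigma> + S))"
  shows "S \<le> \<sigma> + 2 * b * M + (b * \<theta>)\<^sup>2"
proof -
  define r where "r = sqrt (\<sigma> + S)"
  have r: "r\<^sup>2 = \<sigma> + S" using assms by (simp add: r_def)
  have "0 \<le> (r - b * \<theta>)\<^sup>2" by simp
  then have "2 * (b * \<theta> * r) \<le> \<sigma> + S + (b * \<theta>)\<^sup>2"
    by (simp add: power2_diff r algebra_simps)
  moreover have "S \<le> b * M + b * \<theta> * r"
    using assms(3) by (simp add: r_def algebra_simps)
  ultimately show ?thesis by linarith
qed

text \<open>The descent argument for plain sequences: \<open>F\<close> stands for the objective,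
  \<open>s\<close> for the squared gradient norms, \<open>Q\<close> for zero regularization,
  \<open>\<delta>\<close> for the tolerance terms. \<open>H\<close> is the total decrease available,
  including what the error terms can add.\<close>

lemma sum_le_of_adaptive_descent:
  fixes F s \<mu> \<delta> :: "nat \<Rightarrow> real"
  assumes s: "\<And>k. 0 \<le> s k"
    and pos: "0 < \<theta>\<^sub>1" "\<theta>\<^sub>1 \<le> \<theta>\<^sub>2" "0 < \<sigma>" "0 < L" "0 < M" "0 < a\<^sub>0" "0 < a\<^sub>1" "0 \<le> D"
    and \<mu>_lower: "\<And>k. k < n \<Longrightarrow> \<not> Q k \<Longrightarrow> \<theta>\<^sub>1 * sqrt (\<sigma> + (\<Sum>j | j \<le> k \<and> \<not> Q j. s j)) \<le> \<mu> k"
    and \<mu>_upper: "\<And>k. k < n \<Longrightarrow> \<not> Q k \<Longrightarrow> \<mu> k \<le> \<theta>\<^sub>2 * sqrt (\<sigma> + (\<Sum>j | j \<le> k \<and> \<not> Q j. s j))"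
    and zero: "\<And>k. k < n \<Longrightarrow> Q k \<Longrightarrow> F (Suc k) \<le> F k - a\<^sub>0 * s k + \<delta> k"
    and plus: "\<And>k. k < n \<Longrightarrow> \<not> Q k \<Longrightarrow>
      F (Suc k) \<le> F k - a\<^sub>1 * s k / (M + \<mu> k) + (if \<mu> k < L then D * s k else 0)"
    and \<delta>: "(\<Sum>k | k < n \<and> Q k. \<delta> k) \<le> T" and low: "low \<le> F n"
    and H: "H = F 0 - low + T + D * (L / \<theta>\<^sub>1)\<^sup>2"
  shows "(\<Sum>k<n. s k) \<le> H / a\<^sub>0 + (\<sigma> + 2 * (H / a\<^sub>1) * M + (H / a\<^sub>1 * \<theta>\<^sub>2)\<^sup>2)"
proof -
  define Z where "Z = (\<Sum>k | k < n \<and> Q k. s k)"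
  define S where "S = (\<Sum>k | k < n \<and> \<not> Q k. s k)"
  \<comment> \<open>Bounds every denominator \<open>M + \<mu> k\<close> of a regularized step, as
    each running sum is at most \<open>S\<close>.\<close>
  define R where "R = M + \<theta>\<^sub>2 * sqrt (\<sigma> + S)"
  have nonneg: "0 \<le> Z" "0 \<le> S" using s by (auto simp: Z_def S_def intro: sum_nonneg)
  have R: "0 < R" using pos nonneg by (auto simp: R_def intro!: add_pos_nonneg)
  have split: "(\<Sum>k<n. h k) = (\<Sum>k | k < n \<and> Q k. h k) + (\<Sum>k | k < n \<and> \<not> Q k. h k)" for h :: "nat \<Rightarrow> real"
    using sum.Int_Diff[of "{..<n}" h "{k. Q k}"]
    by (simp add: Int_def Diff_eq Compl_eq)
  have stepplus: "F (Suc k) - F k \<le> - (a\<^sub>1 / R) * s k + (if \<mu> k < L then D * s k else 0)"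
    if "k < n" "\<not> Q k" for k
  proof -
    let ?S = "\<Sum>j | j \<le> k \<and> \<not> Q j. s j"
    have "?S \<le> S" "0 \<le> ?S"
      unfolding S_def using s that by (auto intro!: sum_mono2 sum_nonneg)
    then have "\<theta>\<^sub>2 * sqrt (\<sigma> + ?S) \<le> \<theta>\<^sub>2 * sqrt (\<sigma> + S)"
      using pos by (intro mult_left_mono) auto
    then have "M + \<mu> k \<le> R" using \<mu>_upper[OF that] by (simp add: R_def)
    moreover have "0 \<le> \<theta>\<^sub>1 * sqrt (\<sigma> + ?S)"
      using pos \<open>0 \<le> ?S\<close> by simp
    then have "0 < M + \<mu> k" using \<mu>_lower[OF that] pos by linarith
    ultimately have "a\<^sub>1 * s k / R \<le> a\<^sub>1 * s k / (M + \<mu> k)"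
      using s pos R by (intro divide_left_mono) auto
    then show ?thesis using plus[OF that] by (simp add: algebra_simps)
  qed
  have "F n - F 0 = (\<Sum>k<n. F (Suc k) - F k)"
    by (simp add: sum_lessThan_telescope)
  also have "\<dots> = (\<Sum>k | k < n \<and> Q k. F (Suc k) - F k) + (\<Sum>k | k < n \<and> \<not> Q k. F (Suc k) - F k)"
    by (rule split)
  also have "(\<Sum>k | k < n \<and> Q k. F (Suc k) - F k) \<le> (\<Sum>k | k < n \<and> Q k. - a\<^sub>0 * s k + \<delta> k)"
    using zero by (intro sum_mono) (auto simp: algebra_simps)
  also have "\<dots> = - a\<^sub>0 * Z + (\<Sum>k | k < n \<and> Q k. \<delta> k)"
    by (simp add: Z_def sum.distrib sum_distrib_left sum_negf sum_subtractf)
  also have "(\<Sum>k | k < n \<and> \<not> Q k. F (Suc k) - F k)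
      \<le> (\<Sum>k | k < n \<and> \<not> Q k. - (a\<^sub>1 / R) * s k + (if \<mu> k < L then D * s k else 0))"
    using stepplus by (intro sum_mono) auto
  also have "\<dots> = - (a\<^sub>1 / R) * S + D * (\<Sum>k | k < n \<and> \<not> Q k \<and> \<mu> k < L. s k)"
    by (simp add: S_def sum.distrib sum_distrib_left sum_negf sum_subtractf conj_assoc flip: sum.inter_filter)
  also have "(\<Sum>k | k < n \<and> \<not> Q k \<and> \<mu> k < L. s k) \<le> (L / \<theta>\<^sub>1)\<^sup>2"
    using s pos \<mu>_lower by (intro sum_small_regularization_le[where \<sigma> = \<sigma>]) auto
  finally have main: "a\<^sub>0 * Z + a\<^sub>1 / R * S \<le> H"
    using \<delta> low pos by (simp add: H mult_left_mono)
  have "0 \<le> a\<^sub>0 * Z" "0 \<le> a\<^sub>1 / R * S" using nonneg pos R by auto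
  with main have "a\<^sub>0 * Z \<le> H" "a\<^sub>1 / R * S \<le> H" by linarith+
  then have "Z \<le> H / a\<^sub>0" "S \<le> H / a\<^sub>1 * R"
    using pos R by (simp_all add: field_simps)
  \<comment> \<open>\<open>R\<close> contains \<open>sqrt (\<sigma> + S)\<close>, so the bound on
    \<open>S\<close> is implicit and has to be solved.\<close>
  moreover from this(2) have "S \<le> \<sigma> + 2 * (H / a\<^sub>1) * M + (H / a\<^sub>1 * \<theta>\<^sub>2)\<^sup>2"
    using nonneg pos by (intro le_of_le_sqrt_growth) (auto simp: R_def)
  ultimately show ?thesis
    using split[of s] by (simp add: Z_def S_def)
qed

section \<open>Runs of the algorithm\<close>

text \<open>Lets a predicate on indices, the outcome of the test, replace the two evolving
  sets.\<close>

lemma run_index_sets: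
  assumes "run P gradf fbar n R" "k \<le> n"
  shows "Kzero R k = {j. j < k \<and> zero_reg_test fbar R j}"
    and "Kplus R k = {j. j < k \<and> \<not> zero_reg_test fbar R j}"
proof -
  have "Kzero R k = {j. j < k \<and> zero_reg_test fbar R j} \<and>
      Kplus R k = {j. j < k \<and> \<not> zero_reg_test fbar R j}"
    using assms(2)
  proof (induction k)
    case 0
    then show ?case using assms(1) by (simp add: run_def)
  next
    case (Suc k)
    then have "reg_update P gradf fbar R k"
      using assms(1) by (simp add: run_def iteration_def)
    then show ?case
      using Suc by (auto simp: reg_update_def less_Suc_eq split: if_splits)
  qed
  then show "Kzero R k = {j. j < k \<and> zero_reg_test fbar R j}"
    and "Kplus R k = {j. j < k \<and> \<not> zero_reg_test fbar R j}" by auto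
qed

theorem theorem1:
  fixes f fbar :: "real^'n \<Rightarrow> real"
    and gradf :: "real^'n \<Rightarrow> real^'n"
    and P :: "'n alg_params"
    and L m M :: real
  assumes params: "admissible_params P"
    and gradient: "\<And>x. GDERIV f x :> gradf x"
    and cont_gradient: "continuous_on UNIV gradf"
    and noise: "\<And>x. \<bar>f x - fbar x\<bar> \<le> eps_f P * max 1 \<bar>f x\<bar>"
    and bounded_below: "bdd_below (range f)"
    and L_pos: "0 < L"
    and L_smooth: "\<And>x y. f y \<le> f x + gradf x \<bullet> (y - x) + L / 2 * (norm (y - x))\<^sup>2"
    and m_M: "0 < m" "m \<le> M"
  shows "\<exists>C. \<forall>kmax\<ge>1. \<forall>R.
    run P gradf fbar kmax R \<longrightarrow>
    (\<forall>k<kmax. mat m \<preceq>\<^sub>L hess R k \<and> hess R k \<preceq>\<^sub>L mat M) \<longrightarrow>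
    1 / real kmax * (\<Sum>k<kmax. (norm (gradf (iter R k)))\<^sup>2) \<le> C / real kmax"
proof -
  obtain low where low: "\<And>x. low \<le> f x"
    using bounded_below by (auto simp: bdd_below_def)
  \<comment> \<open>All constants up to \<open>C\<close> are fixed before the run and its length. By
    \<open>ls_trial_bounds\<close>, \<open>a\<close> bounds the step sizes from below.\<close>
  define a where "a = min 1 (beta_min P * (2 * (1 - c_ls P) * m / L))"
  \<comment> \<open>For steps with \<open>\<mu> k < L\<close>: the first summand covers the increase
    of \<open>f\<close> that smoothness allows, the second refunds the decrease subtracted in the
    common descent inequality.\<close>
  define D where "D = L / (2 * m\<^sup>2) + a / (2 * M)"
  define lowbar where "lowbar = low - eps_f P * max 1 \<bar>low\<bar>"
  define E where "E = 2 * eps_f P / (1 - eps_f P)"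
  \<comment> \<open>Bounds the tolerance of every step with zero regularization, since such a step
    starts from a measured value not above the initial one.\<close>
  define T where "T = E * max 1 (max (fbar (x_init P)) (- lowbar))"
  define K where "K = 2 / (1 - eps_f P)"
  define H where "H = f (x_init P) - low + K * (fbar (x_init P) - (lowbar - T)) + D * (L / theta_min P)\<^sup>2"
  define C where "C = H / (c_ls P * a / M) +
    (vsig P + 2 * (H / (a / 2)) * M + (H / (a / 2) * theta_max P)\<^sup>2)"
  have e: "0 \<le> eps_f P" "eps_f P < 1" and c: "0 < c_ls P" "c_ls P < 1"
    and \<theta>: "0 < theta_min P" "theta_min P \<le> theta_max P" and \<sigma>: "0 < vsig P"
    and b: "0 < beta_min P"
    using params by (auto simp: admissible_params_def)
  have M: "0 < M" using m_M by linarith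
  have a: "0 < a" "a \<le> 1" using b c m_M L_pos by (auto simp: a_def)
  have D: "0 \<le> D" using a M L_pos by (auto simp: D_def)
  have E: "0 \<le> E" and K: "0 \<le> K" using e by (auto simp: E_def K_def)
  have T: "0 \<le> T" using E by (auto simp: T_def intro!: mult_nonneg_nonneg)
  have lowbar: "lowbar \<le> fbar x" for x
    unfolding lowbar_def using noise_lower[OF e noise low] .
  have "(\<Sum>k<n. (norm (gradf (iter R k)))\<^sup>2) \<le> C"
    if run: "run P gradf fbar n R"
      and hess: "\<forall>k<n. mat m \<preceq>\<^sub>L hess R k \<and> hess R k \<preceq>\<^sub>L mat M" for n R
  proof -
    define Q where "Q = zero_reg_test fbar R"
    define s where "s k = (norm (gradf (iter R k)))\<^sup>2" for k
    define F where "F k = f (iter R k)" for k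
    define \<mu> where "\<mu> = reg R"
    define \<phi> where "\<phi> k = fbar (iter R k)" for k
    have iteration: "iteration P gradf fbar R k" if "k < n" for k
      using run that by (simp add: run_def)
    have iter0: "iter R 0 = x_init P" using run by (simp add: run_def)
    have reg_update: "reg_update P gradf fbar R k" if "k < n" for k
      using iteration[OF that] by (simp add: iteration_def)
    have \<mu>_zero: "\<mu> k = 0" if "k < n" "Q k" for k
      using reg_update[OF that(1)] that(2) by (simp add: reg_update_def Q_def \<mu>_def)
    have \<mu>_plus: "\<exists>\<theta>\<in>{theta_min P..theta_max P}. \<mu> k = \<theta> * sqrt (vsig P + (\<Sum>j | j \<le> k \<and> \<not> Q j. s j))"
      if "k < n" "\<not> Q k" for k
    proof -
      \<comment> \<open>\<open>Kplus\<close> is read after iteration \<open>k\<close>, so the sum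
        includes the current gradient, as \<open>sum_small_regularization_le\<close>
        requires.\<close>
      have eq: "{j \<in> Kplus R (Suc k). j \<le> k} = {j. j \<le> k \<and> \<not> Q j}"
        using run_index_sets(2)[OF run, of "Suc k"] that(1) by (simp add: Q_def less_Suc_eq_le conj_ac)
      show ?thesis
        using reg_update[OF that(1)] that(2)
        unfolding reg_update_def eq by (simp add: Q_def \<mu>_def s_def)
    qed
    have sum_nonneg: "0 \<le> (\<Sum>j | j \<le> k \<and> \<not> Q j. s j)" for k
      by (simp add: s_def sum_nonneg)
    have \<mu>_lower: "theta_min P * sqrt (vsig P + (\<Sum>j | j \<le> k \<and> \<not> Q j. s j)) \<le> \<mu> k"
      and \<mu>_upper: "\<mu> k \<le> theta_max P * sqrt (vsig P + (\<Sum>j | j \<le> k \<and> \<not> Q j. s j))"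
      if "k < n" "\<not> Q k" for k
      using \<mu>_plus[OF that] sum_nonneg[of k] \<sigma> by (auto intro!: mult_right_mono)
    have \<mu>_nonneg: "0 \<le> \<mu> k" if "k < n" for k
      using \<mu>_zero[OF that] \<mu>_plus[OF that] \<theta> \<sigma> sum_nonneg[of k] by (cases "Q k") auto

    have test: "\<phi> k \<le> \<phi> j - tol R j" if "k < n" "Q k" "j < k" "Q j" for j k
    proof -
      have "j \<in> Kzero R k"
        using run_index_sets(1)[OF run, of k] that by (simp add: Q_def)
      then have "ereal (\<phi> k) \<le> ereal (\<phi> j - tol R j)"
        using that(2) unfolding Q_def zero_reg_test_def \<phi>_def
        by (meson INF_lower order_trans)
      then show ?thesis by simp
    qed
    \<comment> \<open>The infimum over the empty set is \<open>\<infinity>\<close>, so index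
      \<open>0\<close> passes the test and is the reference for all later ones.\<close>
    have Q0: "Q 0" using run by (simp add: Q_def zero_reg_test_def run_def top_ereal_def)
    have tol: "tol R k = E * max 1 (max (\<phi> k) (- \<phi> (Suc k)))" if "k < n" for k
      using iteration[OF that] by (simp add: iteration_def ls_tol_def E_def \<phi>_def)
    then have tol_nonneg: "0 \<le> tol R k" if "k < n" for k
      using that E by (simp add: mult_nonneg_nonneg)
    have \<phi>_le: "\<phi> k \<le> \<phi> 0" if "k < n" "Q k" for k
      using test[OF that, of 0] Q0 tol_nonneg[of 0] that by (cases "k = 0") auto
    have "tol R k \<le> T" if "k < n" "Q k" for k
    proof -
      have "max 1 (max (\<phi> k) (- \<phi> (Suc k))) \<le> max 1 (max (fbar (x_init P)) (- lowbar))"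
        using \<phi>_le[OF that] lowbar[of "iter R (Suc k)"] by (auto simp: \<phi>_def iter0)
      then show ?thesis
        unfolding tol[OF that(1)] T_def using E by (intro mult_left_mono)
    qed
    \<comment> \<open>No later test limits the last selected tolerance; the lower bound
      \<open>lowbar - T\<close> does.\<close>
    then have tol_sum: "(\<Sum>k | k < n \<and> Q k. tol R k) \<le> fbar (x_init P) - (lowbar - T)"
      using test \<phi>_le T lowbar order_trans[OF _ lowbar, of "lowbar - T"]
      by (intro sum_tolerances_le[where \<phi> = \<phi>]) (auto simp: \<phi>_def iter0 intro: diff_mono)

    have direction:
      "(m + \<mu> k) * (norm (dir R k))\<^sup>2 \<le> - (gradf (iter R k) \<bullet> dir R k)"
      "s k \<le> (M + \<mu> k) * - (gradf (iter R k) \<bullet> dir R k)"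
      "(m + \<mu> k) * norm (dir R k) \<le> norm (gradf (iter R k))"
      if "k < n" for k
      using regularized_newton_direction[of "hess R k" m M "\<mu> k" "dir R k" "gradf (iter R k)"]
        iteration[OF that] hess that m_M \<mu>_nonneg[OF that]
      by (auto simp: iteration_def \<mu>_def s_def)
    have direction_m: "m * (norm (dir R k))\<^sup>2 \<le> - (gradf (iter R k) \<bullet> dir R k)" if "k < n" for k
      by (rule order_trans[OF _ direction(1)[OF that]])
        (use \<mu>_nonneg[OF that] in \<open>simp add: mult_right_mono\<close>)
    have step_size: "a \<le> stepsize R k" "stepsize R k \<le> 1"
      and accepted: "\<not> ls_rejects P fbar (iter R k) (gradf (iter R k)) (dir R k) (stepsize R k)"
      if "k < n" for k
      using ls_trial_bounds[OF params noise L_pos m_M(1) L_smooth direction_m[OF that]]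
        iteration[OF that] by (auto simp: iteration_def ls_accepts_def a_def)
    have next_iter: "iter R (Suc k) = iter R k + stepsize R k *\<^sub>R dir R k" if "k < n" for k
      using iteration[OF that] by (simp add: iteration_def)

    have zero: "F (Suc k) \<le> F k - (c_ls P * a / M) * s k + K * tol R k" if "k < n" "Q k" for k
    proof -
      define q where "q = - (gradf (iter R k) \<bullet> dir R k)"
      have "s k / M \<le> q"
        using direction(2)[OF that(1)] \<mu>_zero[OF that] M by (simp add: q_def field_simps)
      moreover have "0 \<le> s k" by (simp add: s_def)
      ultimately have "c_ls P * a * (s k / M) \<le> c_ls P * stepsize R k * q"
        using c a M step_size[OF that(1)] by (intro mult_mono) auto
      moreover have "F (Suc k) \<le> F k - c_ls P * stepsize R k * q + K * tol R k"
        using accepted_step_decrease[OF params noise L_pos m_M(1) L_smooth direction_m[OF that(1)]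
            _ accepted[OF that(1)]] step_size[OF that(1)] a iteration[OF that(1)]
        by (simp add: F_def q_def K_def iteration_def)
      ultimately show ?thesis by simp
    qed

    have plus: "F (Suc k) \<le> F k - a / 2 * s k / (M + \<mu> k) + (if \<mu> k < L then D * s k else 0)"
      if "k < n" "\<not> Q k" for k
    proof -
      define q where "q = - (gradf (iter R k) \<bullet> dir R k)"
      define \<alpha> where "\<alpha> = stepsize R k"
      define N where "N = (norm (dir R k))\<^sup>2"
      have \<alpha>: "a \<le> \<alpha>" "0 \<le> \<alpha>" "\<alpha> \<le> 1" using step_size[OF that(1)] a by (auto simp: \<alpha>_def)
      have \<mu>: "0 \<le> \<mu> k" by (rule \<mu>_nonneg[OF that(1)])
      have s: "0 \<le> s k" and N: "0 \<le> N" by (auto simp: s_def N_def)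
      have smooth: "F (Suc k) \<le> F k - \<alpha> * q + L / 2 * \<alpha>\<^sup>2 * N"
        using smooth_along_direction[OF params noise L_pos m_M(1) L_smooth direction_m[OF that(1)]]
        by (simp add: F_def \<alpha>_def q_def N_def next_iter[OF that(1)])
      have \<alpha>2: "\<alpha>\<^sup>2 \<le> \<alpha>" using \<alpha> by (simp add: power2_eq_square mult_left_le)
      have q: "s k / (M + \<mu> k) \<le> q"
        using direction(2)[OF that(1)] \<mu> M by (simp add: q_def pos_divide_le_eq mult.commute)
      have q0: "0 \<le> q" by (rule order_trans[OF _ q]) (use s \<mu> M in simp)
      show ?thesis
      proof (cases "\<mu> k < L")
        case True
        \<comment> \<open>The linear term is used only as nonpositive; the bound on the direction
          turns the quadratic term into a multiple of \<open>s k\<close>, charged to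
          \<open>D\<close>.\<close>
        have "m * norm (dir R k) \<le> norm (gradf (iter R k))"
          by (rule order_trans[OF _ direction(3)[OF that(1)]]) (use \<mu> in \<open>simp add: mult_right_mono\<close>)
        then have "(m * norm (dir R k))\<^sup>2 \<le> s k"
          unfolding s_def using m_M by (intro power_mono) auto
        then have "N \<le> s k / m\<^sup>2"
          using m_M by (simp add: N_def power_mult_distrib pos_le_divide_eq mult.commute)
        moreover have "\<alpha>\<^sup>2 \<le> 1" using \<alpha>2 \<alpha> by linarith
        ultimately have "L / 2 * \<alpha>\<^sup>2 * N \<le> L / 2 * 1 * (s k / m\<^sup>2)"
          using N L_pos by (intro mult_mono) auto
        moreover have "a / 2 * s k / (M + \<mu> k) \<le> a / 2 * s k / M"
          using a s M \<mu> by (intro divide_left_mono) auto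
        moreover have "0 \<le> \<alpha> * q" using \<alpha> q0 by simp
        ultimately show ?thesis
          using smooth True by (simp add: D_def algebra_simps)
      next
        case False
        \<comment> \<open>With \<open>\<mu> k \<ge> L\<close> the quadratic term takes at most half
          of the linear decrease \<open>\<alpha> * q\<close>, which leaves the factor
          \<open>a / 2\<close>.\<close>
        have "L * N \<le> (m + \<mu> k) * N"
          using False m_M N by (intro mult_right_mono) auto
        also have "\<dots> \<le> q"
          using direction(1)[OF that(1)] by (simp add: q_def N_def)
        finally have "\<alpha>\<^sup>2 * (L * N) \<le> \<alpha> * q"
          using \<alpha>2 \<alpha> N L_pos by (intro mult_mono) auto
        moreover define r where "r = s k / (M + \<mu> k)"
        have "a * r \<le> \<alpha> * q"
          using \<alpha> q a s \<mu> M unfolding r_def by (intro mult_mono) auto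
        ultimately have "F (Suc k) \<le> F k - a / 2 * r"
          using smooth by (simp add: mult_ac)
        then show ?thesis using False by (simp add: r_def)
      qed
    qed

    have "(\<Sum>k<n. s k) \<le> C"
      unfolding C_def
    \<comment> \<open>The \<open>T\<close> of the rule bounds the sum of the weighted tolerances and
      differs from the local \<open>T\<close>; \<open>a\<^sub>0\<close> and \<open>a\<^sub>1\<close>
      become \<open>c_ls P * a / M\<close> and \<open>a / 2\<close>.\<close>
    proof (rule sum_le_of_adaptive_descent[where F = F and \<mu> = \<mu> and \<delta> = "\<lambda>k. K * tol R k"
          and Q = Q and low = low and D = D and L = L and \<theta>\<^sub>1 = "theta_min P"
          and T = "K * (fbar (x_init P) - (lowbar - T))"])
      show "(\<Sum>k | k < n \<and> Q k. K * tol R k) \<le> K * (fbar (x_init P) - (lowbar - T))"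
        using mult_left_mono[OF tol_sum K] by (simp add: sum_distrib_left)
      show "H = F 0 - low + K * (fbar (x_init P) - (lowbar - T)) + D * (L / theta_min P)\<^sup>2"
        by (simp add: H_def F_def iter0)
      show "low \<le> F n" by (simp add: F_def low)
      show "0 \<le> s k" for k by (simp add: s_def)
    qed (use \<theta> \<sigma> L_pos M a c D \<mu>_lower \<mu>_upper zero plus in auto)
    then show ?thesis by (simp add: s_def)
  qed
  then show ?thesis
    by (intro exI[of _ C]) (simp add: divide_right_mono)
qed

end
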